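(* Let $h$ and $k$ be positive integers and let $q$ be a prime power with $q\ge hk+1$. Then the set $$\mathcal{P}_{h,k,q}:=\{X(P_{\alpha}) = X^*(P_{\alpha})\cap\Sigma \;:\; \alpha\in\Lambda_{h,q}\}$$ is a pseudo-arc in $\Sigma\simeq\mathrm{PG}(hk-1,q)$ having size $|\Lambda_{h,q}|$.
   Context: $\mathrm{PG}(m-1,q)$ is the $(m-1)$-dimensional projective space over $\mathbb{F}_q$; all dimensions are projective. A pseudo-arc in $\mathrm{PG}(hk-1,q)$ is a set of $(h-1)$-dimensional projective subspaces such that every subset of $k$ of them spans the entire space. $\Sigma\simeq \mathrm{PG}(hk-1,q)$ is the canonical subgeometry of $\mathrm{PG}(hk-1,q^h)$, consisting of the points $\langle(x_1,\dots,x_{hk})\rangle_{\mathbb{F}_{q^h}}$ with $(x_1,\dots,x_{hk})\in\mathbb{F}_q^{hk}\setminus\{0\}$. It is the set of fixed points of the semilinear collineation $\Psi:\langle(x_1,\dots,x_{hk})\rangle_{\mathbb{F}_{q^h}}\mapsto\langle(x_1^q,\dots,x_{hk}^q)\rangle_{\mathbb{F}_{q^h}}$ of $\mathrm{PG}(hk-1,q^h)$, which has order $h$. For a point $P$ of $\mathrm{PG}(hk-1,q^h)$, $X^*(P):=\langle P,P^{\Psi},\dots,P^{\Psi^{h-1}}\rangle_{\mathbb{F}_{q^h}}$ and $X(P):=X^*(P)\cap\Sigma$, regarded as a subspace of $\Sigma$. For $\alpha\in\mathbb{F}_{q^h}$, $P_\alpha:=\langle(1,\alpha,\alpha^2,\dots,\alpha^{hk-1})\rangle_{\mathbb{F}_{q^h}}$.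 $\Lambda_{h,q}$ is a set of representatives of the orbits of size $h$ of $\mathbb{F}_{q^h}$ under the $q$-Frobenius automorphism $x\mapsto x^q$ (so $\mathbb{F}_q(\alpha)=\mathbb{F}_{q^h}$ for all $\alpha\in\Lambda_{h,q}$).
   Formalization: The size claim is proved only for k ≥ 2: for k = 1 every X(P_α) is the whole of Σ, so the set has one element while |Λ_{h,q}| > 1 (e.g. h = k = 1, q = 2 gives |Λ| = 2). The pseudo-arc claim is proved for all k ≥ 1. *)

theory Defs
  imports "Jordan_Normal_Form.VS_Connect" "HOL-Library.Cardinality"
    "HOL-Number_Theory.Prime_Powers" "HOL-Combinatorics.Orbits"
begin

text \<open>Everything takes place over one ambient finite field, the type \<open>'a\<close>, of order \<open>q ^ h\<close>.
  Its unique subfield of order \<open>q\<close> is the set of roots of \<open>x ^ q = x\<close>.\<close>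

definition Fq :: "nat \<Rightarrow> 'a::field set" where
  "Fq q = {x. x ^ q = x}"

text \<open>For a subfield \<open>K\<close> of \<open>'a\<close>: \<open>K\<close> as a ring, and \<open>K\<^sup>n\<close> as a vector space over it, with the
  operations inherited from \<open>'a\<close> and from \<open>'a vec\<close>.\<close>

definition scalar_field :: "'a::field set \<Rightarrow> 'a ring" where
  "scalar_field K = class_ring\<lparr>carrier := K\<rparr>"

definition coord_space :: "'a::field set \<Rightarrow> nat \<Rightarrow> ('a, 'a vec) module" where
  "coord_space K n =
     (module_vec TYPE('a) n)\<lparr>carrier := {v \<in> carrier_vec n. \<forall>i<n. v $ i \<in> K}\<rparr>"

text \<open>The projective point spanned by \<open>v\<close>, always over the full field \<open>'a\<close>. Hence for
  \<open>K = UNIV\<close> the geometry below is \<open>PG(n-1, q\<^sup>h)\<close>, and for a proper subfield \<open>K\<close> it is the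
  canonical subgeometry isomorphic to \<open>PG(n-1, K)\<close>, whose points are points of \<open>PG(n-1, q\<^sup>h)\<close>.\<close>

definition proj_point :: "'a::field vec \<Rightarrow> 'a vec set" where
  "proj_point v = range (\<lambda>c. c \<cdot>\<^sub>v v)"

definition points_of :: "nat \<Rightarrow> 'a::field vec set \<Rightarrow> 'a vec set set" where
  "points_of n W = proj_point ` (W - {0\<^sub>v n})"

definition PG_points :: "'a::field set \<Rightarrow> nat \<Rightarrow> 'a vec set set" where
  "PG_points K n = points_of n (carrier (coord_space K n))"

text \<open>Projective subspaces are sets of points. The empty set is a projective subspace; it has no
  dimension in the sense of \<open>proj_subspace_dim\<close> (it would be \<open>-1\<close>).\<close>

definition proj_subspace :: "'a::field set \<Rightarrow> nat \<Rightarrow> 'a vec set set \<Rightarrow> bool" where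
  "proj_subspace K n U \<longleftrightarrow>
     (\<exists>W. VectorSpace.subspace (scalar_field K) W (coord_space K n) \<and> U = points_of n W)"

definition proj_subspace_dim :: "'a::field set \<Rightarrow> nat \<Rightarrow> nat \<Rightarrow> 'a vec set set \<Rightarrow> bool" where
  "proj_subspace_dim K n d U \<longleftrightarrow>
     (\<exists>W. VectorSpace.subspace (scalar_field K) W (coord_space K n) \<and>
          vectorspace.dim (scalar_field K) ((coord_space K n)\<lparr>carrier := W\<rparr>) = d + 1 \<and>
          U = points_of n W)"

definition proj_span :: "'a::field set \<Rightarrow> nat \<Rightarrow> 'a vec set set \<Rightarrow> 'a vec set set" where
  "proj_span K n A = \<Inter> {U. proj_subspace K n U \<and> A \<subseteq> U}"

definition pseudo_arc :: "'a::field set \<Rightarrow> nat \<Rightarrow> nat \<Rightarrow> 'a vec set set set \<Rightarrow> bool" where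
  "pseudo_arc K h k \<P> \<longleftrightarrow>
     (\<forall>U\<in>\<P>. proj_subspace_dim K (h * k) (h - 1) U) \<and>
     (\<forall>T\<subseteq>\<P>. finite T \<and> card T = k \<longrightarrow> proj_span K (h * k) (\<Union>T) = PG_points K (h * k))"

definition Sigma_sub :: "nat \<Rightarrow> nat \<Rightarrow> 'a::field vec set set" where
  "Sigma_sub q n = PG_points (Fq q) n"

text \<open>The collineation \<open>\<Psi>\<close> on points. The image of the line of scalar multiples of \<open>x\<close> under the
  coordinatewise Frobenius map is the line of scalar multiples of the image of \<open>x\<close>, since
  \<open>c \<mapsto> c ^ q\<close> is a bijection of a finite field whose characteristic divides \<open>q\<close>.\<close>

definition Psi :: "nat \<Rightarrow> 'a::field vec set \<Rightarrow> 'a vec set" where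
  "Psi q P = map_vec (\<lambda>x. x ^ q) ` P"

definition X_star :: "nat \<Rightarrow> nat \<Rightarrow> nat \<Rightarrow> 'a::field vec set \<Rightarrow> 'a vec set set" where
  "X_star q h n P = proj_span UNIV n ((\<lambda>i. (Psi q ^^ i) P) ` {..<h})"

definition X_sub :: "nat \<Rightarrow> nat \<Rightarrow> nat \<Rightarrow> 'a::field vec set \<Rightarrow> 'a vec set set" where
  "X_sub q h n P = X_star q h n P \<inter> Sigma_sub q n"

definition P_pt :: "nat \<Rightarrow> 'a::field \<Rightarrow> 'a vec set" where
  "P_pt n \<alpha> = proj_point (vec n (\<lambda>i. \<alpha> ^ i))"

text \<open>\<open>\<Lambda>\<close> consists of exactly one element from each orbit of size \<open>h\<close> of the \<open>q\<close>-Frobenius map,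
  and of nothing else. (\<open>orbit f x\<close> is the forward orbit, which is the orbit under the
  generated group because Frobenius is a permutation of the finite field.)\<close>

definition frob_orbits_of_size :: "nat \<Rightarrow> nat \<Rightarrow> 'a::field set set" where
  "frob_orbits_of_size h q = {B. (\<exists>x. B = orbit (\<lambda>y. y ^ q) x) \<and> card B = h}"

definition is_Lambda :: "nat \<Rightarrow> nat \<Rightarrow> 'a::field set \<Rightarrow> bool" where
  "is_Lambda h q \<Lambda> \<longleftrightarrow>
     \<Lambda> \<subseteq> \<Union> (frob_orbits_of_size h q) \<and>
     (\<forall>B \<in> frob_orbits_of_size h q. \<exists>!\<alpha>. \<alpha> \<in> B \<inter> \<Lambda>)"

text \<open>A set, not an indexed family: for \<open>k = 1\<close> every \<open>X(P\<^sub>\<alpha>)\<close> is the whole of \<open>\<Sigma>\<close>, so it has at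
  most one element, and only for \<open>k \<ge> 2\<close> can its size be compared with that of \<open>\<Lambda>\<close>.\<close>

definition P_family :: "nat \<Rightarrow> nat \<Rightarrow> nat \<Rightarrow> 'a::field set \<Rightarrow> 'a vec set set set" where
  "P_family h k q \<Lambda> = {X_sub q h (h * k) (P_pt (h * k) \<alpha>) |\<alpha>. \<alpha> \<in> \<Lambda>}"

end

theory Submission
  imports Defs "HOL-Number_Theory.Residues"
begin

text \<open>Let \<open>F\<close> be the field of order \<open>q\<^sup>h\<close>, \<open>K\<close> its subfield of order \<open>q\<close>, \<open>n = h k\<close>, and
  \<open>v(x) = (1, x, \<dots>, x\<^sup>n\<^sup>-\<^sup>1)\<close>. Everything rests on the fact that any \<open>n\<close> or fewer vectors \<open>v(x)\<close>
  with distinct \<open>x\<close> are linearly independent over \<open>F\<close> (\<open>vandermonde_independent\<close>). Since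
  \<open>\<Lambda>\<close> has one representative of each orbit of size \<open>h\<close>, the conjugates of its
  elements are all distinct (\<open>is_Lambda_conjugates_distinct\<close>), so the conjugates of any \<open>k\<close> elements
  of \<open>\<Lambda>\<close> give exactly \<open>n\<close> independent vectors.

  The subspace \<open>X\<^sup>*(P\<^sub>\<alpha>)\<close> consists of the combinations \<open>a\<^sub>0 v(\<alpha>) + \<dots> + a\<^sub>h\<^sub>-\<^sub>1 v(\<alpha>\<^bsup>q^(h-1)\<^esup>)\<close>. Such a vector
  lies in \<open>K\<^sup>n\<close> iff the Frobenius map fixes it; as Frobenius permutes the \<open>v\<close>'s cyclically and they are
  independent, this means that \<open>a\<^sub>i = c\<^bsup>q^i\<^esup>\<close> for a single \<open>c \<in> F\<close>. Hence \<open>X(P\<^sub>\<alpha>)\<close> is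
  the set of points of the trace code \<open>{(Tr(c), Tr(c \<alpha>), \<dots>, Tr(c \<alpha>\<^sup>n\<^sup>-\<^sup>1)) | c \<in> F}\<close>
  (\<open>X_sub_P_pt\<close>).

  From here on one only counts. A trace code is parametrised injectively by \<open>c \<in> F\<close>, so it has \<open>q\<^sup>h\<close>
  elements and dimension \<open>h\<close> over \<open>K\<close>. For \<open>k\<close> elements of \<open>\<Lambda>\<close>, the sums of one codeword from each
  trace code are parametrised injectively by \<open>F\<^sup>k\<close>, again by independence
  (\<open>traces_independent\<close>). There are \<open>q\<^sup>h\<^sup>k\<close> of them, as many as there are vectors in \<open>K\<^sup>n\<close>, so the
  \<open>k\<close> trace codes span \<open>K\<^sup>n\<close> (\<open>trace_codes_span\<close>). For \<open>k \<ge> 2\<close> the independence for two elements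
  of \<open>\<Lambda>\<close> shows that their trace codes meet only in \<open>0\<close>; in particular they differ, which
  gives the size of the family.\<close>

section \<open>Vandermonde independence\<close>

text \<open>The relation is linear in the powers of \<open>f i\<close>, so it holds with \<open>f i ^ j\<close> replaced by any polynomial
  in \<open>f i\<close> of degree less than \<open>n\<close>. The product of the \<open>X - f t\<close> over \<open>t \<noteq> i\<close> isolates the term of \<open>i\<close>.\<close>

lemma vandermonde_independent:
  fixes f c :: "'i \<Rightarrow> 'a::field"
  assumes fin: "finite I" and inj: "inj_on f I" and card: "card I \<le> n"
    and zero: "\<And>j. j < n \<Longrightarrow> (\<Sum>i\<in>I. c i * f i ^ j) = 0"
    and i: "i \<in> I"
  shows "c i = 0"
proof -
  define p where "p = (\<Prod>t\<in>I - {i}. [:- f t, 1:])"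
  have "degree p \<le> (\<Sum>t\<in>I - {i}. degree [:- f t, 1:])"
    unfolding p_def using degree_prod_sum_le[of "I - {i}" "\<lambda>t. [:- f t, 1:]"] fin
    by (simp add: o_def)
  also have "\<dots> = card I - 1"
    using i by simp
  also have "\<dots> < n"
    using card i fin card_gt_0_iff[of I] by fastforce
  finally have deg: "degree p < n" .
  have "0 = (\<Sum>j\<le>degree p. Polynomial.coeff p j * (\<Sum>t\<in>I. c t * f t ^ j))"
    using deg zero by simp
  also have "\<dots> = (\<Sum>j\<le>degree p. \<Sum>t\<in>I. c t * (Polynomial.coeff p j * f t ^ j))"
    by (simp add: sum_distrib_left mult_ac)
  also have "\<dots> = (\<Sum>t\<in>I. c t * poly p (f t))"
    by (subst sum.swap) (simp add: poly_altdef sum_distrib_left)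
  also have "\<dots> = (\<Sum>t\<in>I. if t = i then c i * poly p (f i) else 0)"
    using fin by (intro sum.cong) (auto simp: p_def poly_prod)
  also have "\<dots> = c i * poly p (f i)"
    using fin i by simp
  finally have "c i * poly p (f i) = 0"
    by simp
  moreover have "poly p (f i) \<noteq> 0"
    using fin i inj by (auto simp: p_def poly_prod inj_on_def)
  ultimately show ?thesis
    by simp
qed


section \<open>Subspaces and projective spans\<close>

abbreviation coord_vecs :: "'a::field set \<Rightarrow> nat \<Rightarrow> 'a vec set" where
  "coord_vecs K n \<equiv> {v \<in> carrier_vec n. \<forall>i<n. v $ i \<in> K}"

lemma card_coord_vecs:
  fixes K :: "'a::{field,finite} set"
  shows "finite (coord_vecs K n)" "card (coord_vecs K n) = card K ^ n"
proof -
  have "bij_betw (\<lambda>f. vec n f) ({..<n} \<rightarrow>\<^sub>E K) (coord_vecs K n)"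
  proof (rule bij_betw_byWitness[where f' = "\<lambda>v. \<lambda>i\<in>{..<n}. v $ i"])
    show "\<forall>f\<in>{..<n} \<rightarrow>\<^sub>E K. (\<lambda>i\<in>{..<n}. vec n f $ i) = f"
      by (auto simp: fun_eq_iff PiE_def extensional_def)
    show "\<forall>v\<in>coord_vecs K n. vec n (\<lambda>i\<in>{..<n}. v $ i) = v"
      by (auto intro!: eq_vecI)
    show "(\<lambda>f. vec n f) ` ({..<n} \<rightarrow>\<^sub>E K) \<subseteq> coord_vecs K n"
      using PiE_mem by fastforce
    show "(\<lambda>v. \<lambda>i\<in>{..<n}. v $ i) ` coord_vecs K n \<subseteq> {..<n} \<rightarrow>\<^sub>E K"
      by (intro image_subsetI PiE_I) auto
  qed
  note bij = this
  have "finite ({..<n} \<rightarrow>\<^sub>E K)"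
    by (intro finite_PiE) auto
  with bij show "finite (coord_vecs K n)"
    using bij_betw_finite by blast
  from bij_betw_same_card[OF bij] show "card (coord_vecs K n) = card K ^ n"
    by (simp add: card_PiE)
qed

text \<open>Coordinates with respect to a basis are a bijection. This reduces the computation of the dimension
  of a subspace over a finite field to a count of its vectors.\<close>

lemma (in vectorspace) card_eq_card_power_dim:
  assumes "finite (carrier V)"
  shows "card (carrier V) = card (carrier K) ^ dim"
proof -
  have "span (carrier V) = carrier V"
    using span_closed[of "carrier V"] span_mem[of "carrier V"] by blast
  hence "fin_dim"
    using assms unfolding fin_dim_def by blast
  then obtain B where B: "finite B" "basis B"
    using finite_basis_exists by blast
  hence sub: "B \<subseteq> carrier V"
    unfolding basis_def by blast
  have crit: "\<forall>v. v \<in> carrier V \<longrightarrow> (\<exists>!a. a \<in> B \<rightarrow>\<^sub>E carrier K \<and> lincomb a B = v)"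
    using basis_criterion[OF B(1) sub] B(2) by blast
  have "bij_betw (\<lambda>a. lincomb a B) (B \<rightarrow>\<^sub>E carrier K) (carrier V)"
    unfolding bij_betw_def
  proof
    have cl: "lincomb a B \<in> carrier V" if "a \<in> B \<rightarrow>\<^sub>E carrier K" for a
      using that sub by (intro lincomb_closed) auto
    show "inj_on (\<lambda>a. lincomb a B) (B \<rightarrow>\<^sub>E carrier K)"
      using crit cl unfolding inj_on_def by metis
    show "(\<lambda>a. lincomb a B) ` (B \<rightarrow>\<^sub>E carrier K) = carrier V"
      using crit cl by blast
  qed
  from bij_betw_same_card[OF this] show ?thesis
    using dim_basis[OF B] B(1) by (simp add: card_PiE)
qed

lemma scalar_field_simps [simp]:
  "carrier (scalar_field K) = K" "monoid.mult (scalar_field K) = (*)" "add (scalar_field K) = (+)"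
  "one (scalar_field K) = 1" "zero (scalar_field K) = 0"
  by (simp_all add: scalar_field_def)

lemma coord_space_simps [simp]:
  "carrier (coord_space K n) = coord_vecs K n" "add (coord_space K n) = (+)"
  "zero (coord_space K n) = 0\<^sub>v n" "module.smult (coord_space K n) = (\<cdot>\<^sub>v)"
  by (simp_all add: coord_space_def module_vec_simps)

lemma field_scalar_fieldI:
  assumes "0 \<in> K" "1 \<in> K"
    and add: "\<And>x y. x \<in> K \<Longrightarrow> y \<in> K \<Longrightarrow> x + y \<in> K"
    and mult: "\<And>x y. x \<in> K \<Longrightarrow> y \<in> K \<Longrightarrow> x * y \<in> K"
    and neg: "\<And>x. x \<in> K \<Longrightarrow> - x \<in> K"
    and inv: "\<And>x. x \<in> K \<Longrightarrow> inverse x \<in> K"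
  shows "field (scalar_field K)"
proof -
  have negE: "\<exists>y\<in>K. x + y = 0 \<and> y + x = 0" if "x \<in> K" for x
    using neg[OF that] by (intro bexI[of _ "- x"]) auto
  have invE: "\<exists>y\<in>K. y * x = 1 \<and> x * y = 1" if "x \<in> K" "x \<noteq> 0" for x
    using inv[OF that(1)] that(2) by (intro bexI[of _ "inverse x"]) auto
  show ?thesis
    using assms negE invE
    by unfold_locales (auto simp: Units_def algebra_simps)
qed

lemma scalar_field_closed:
  assumes "field (scalar_field K)"
  shows "0 \<in> K" "1 \<in> K" "x \<in> K \<Longrightarrow> y \<in> K \<Longrightarrow> x + y \<in> K" "x \<in> K \<Longrightarrow> y \<in> K \<Longrightarrow> x * y \<in> K"
    "x \<in> K \<Longrightarrow> - x \<in> K" "x \<in> K \<Longrightarrow> inverse x \<in> K"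
proof -
  interpret K: field "scalar_field K" by fact
  show "0 \<in> K" "1 \<in> K" "x \<in> K \<Longrightarrow> y \<in> K \<Longrightarrow> x + y \<in> K" "x \<in> K \<Longrightarrow> y \<in> K \<Longrightarrow> x * y \<in> K"
    using K.zero_closed K.one_closed K.a_closed[of x y] K.m_closed[of x y] by auto
  show "- x \<in> K" if "x \<in> K"
    using K.a_inv_closed[of x] K.l_neg[of x] that
    by (simp add: eq_neg_iff_add_eq_0[symmetric])
  show "inverse x \<in> K" if "x \<in> K"
  proof (cases "x = 0")
    case False
    hence "x \<in> Units (scalar_field K)"
      using that by (simp add: K.field_Units)
    then obtain y where "y \<in> K" "y * x = 1"
      by (auto simp: Units_def)
    thus ?thesis
      by (metis inverse_unique mult.commute)
  qed (use that in simp)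
qed

lemma field_scalar_field_UNIV: "field (scalar_field (UNIV :: 'a::field set))"
  by (rule field_scalar_fieldI) auto

lemma vectorspace_coord_space:
  assumes "field (scalar_field K)"
  shows "vectorspace (scalar_field K) (coord_space K n)"
proof -
  note cl = scalar_field_closed[OF assms]
  have neg: "\<exists>w\<in>coord_vecs K n. v + w = 0\<^sub>v n" if "v \<in> coord_vecs K n" for v
    using that cl(5) by (intro bexI[of _ "- v"]) (auto intro!: eq_vecI)
  show ?thesis
    by (rule vs_criteria)
       (use assms cl neg in \<open>auto intro!: eq_vecI simp: algebra_simps\<close>)
qed

lemma subspace_coord_space_iff:
  assumes "field (scalar_field K)"
  shows "VectorSpace.subspace (scalar_field K) W (coord_space K n) \<longleftrightarrow>
    W \<subseteq> coord_vecs K n \<and> 0\<^sub>v n \<in> W \<and> (\<forall>v\<in>W. \<forall>w\<in>W. v + w \<in> W) \<and>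
    (\<forall>c\<in>K. \<forall>v\<in>W. c \<cdot>\<^sub>v v \<in> W)"
proof -
  have vs: "vectorspace (scalar_field K) (coord_space K n)"
    by (rule vectorspace_coord_space[OF assms])
  hence m: "Module.module (scalar_field K) (coord_space K n)"
    by (simp add: vectorspace_def)
  show ?thesis
    using vs m unfolding VectorSpace.subspace_def LinearCombinations.submodule_def
    by auto
qed

text \<open>A point does not remember which multiple of a vector spans it, and the multiples in question are those
  by the whole field, not only by \<open>K\<close>. A subspace over \<open>K\<close> can nevertheless be recovered from its
  points: if two vectors over \<open>K\<close> span the same point, their ratio is a quotient of
  nonzero coordinates and hence lies in \<open>K\<close>. All comparisons of point sets below go through
  this passage back to vectors.\<close>

lemma points_of_subset_imp_subset:
  assumes K: "field (scalar_field K)"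
    and W: "VectorSpace.subspace (scalar_field K) W (coord_space K n)"
    and U: "U \<subseteq> coord_vecs K n"
    and sub: "points_of n U \<subseteq> points_of n W"
  shows "U \<subseteq> W"
proof
  fix u assume u: "u \<in> U"
  note W' = W[unfolded subspace_coord_space_iff[OF K]]
  show "u \<in> W"
  proof (cases "u = 0\<^sub>v n")
    case False
    hence "proj_point u \<in> points_of n W"
      using u sub by (auto simp: points_of_def)
    then obtain w where w: "w \<in> W" "w \<noteq> 0\<^sub>v n" "proj_point u = proj_point w"
      by (auto simp: points_of_def)
    have "u \<in> proj_point u"
      unfolding proj_point_def by (rule range_eqI[of _ _ 1]) simp
    hence "u \<in> proj_point w"
      using w(3) by simp
    then obtain c where c: "u = c \<cdot>\<^sub>v w"
      by (auto simp: proj_point_def)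
    have dim: "w \<in> coord_vecs K n" "u \<in> coord_vecs K n"
      using W' w(1) u U by auto
    then obtain j where j: "j < n" "w $ j \<noteq> 0"
      using w(2) by (auto simp: vec_eq_iff)
    have "u $ j = c * w $ j"
      using c j(1) dim by auto
    hence "c = u $ j * inverse (w $ j)"
      using j(2) by simp
    also have "\<dots> \<in> K"
      using dim j scalar_field_closed[OF K] by auto
    finally show ?thesis
      using W' w(1) c by blast
  qed (use W' in simp)
qed

lemma proj_span_eqI:
  assumes "VectorSpace.subspace (scalar_field K) W (coord_space K n)"
    and "A \<subseteq> points_of n W"
    and "\<And>W'. VectorSpace.subspace (scalar_field K) W' (coord_space K n) \<Longrightarrow>
               A \<subseteq> points_of n W' \<Longrightarrow> W \<subseteq> W'"
  shows "proj_span K n A = points_of n W"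
proof
  show "proj_span K n A \<subseteq> points_of n W"
    using assms(1,2) unfolding proj_span_def proj_subspace_def by blast
  show "points_of n W \<subseteq> proj_span K n A"
    using assms(3) unfolding proj_span_def proj_subspace_def points_of_def by blast
qed

lemma subspace_sum_vec_closed:
  fixes f :: "'i \<Rightarrow> nat \<Rightarrow> 'a::field"
  assumes K: "field (scalar_field K)"
    and W: "VectorSpace.subspace (scalar_field K) W (coord_space K n)"
    and fin: "finite I" and mem: "\<And>i. i \<in> I \<Longrightarrow> vec n (f i) \<in> W"
  shows "vec n (\<lambda>j. \<Sum>i\<in>I. f i j) \<in> W"
  using fin mem
proof (induction I rule: finite_induct)
  case empty
  have "vec n (\<lambda>j. 0 :: 'a) = 0\<^sub>v n"
    by auto
  thus ?case
    using W subspace_coord_space_iff[OF K] by simp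
next
  case (insert i I)
  have "vec n (\<lambda>j. \<Sum>i\<in>insert i I. f i j) = vec n (f i) + vec n (\<lambda>j. \<Sum>i\<in>I. f i j)"
    using insert.hyps by auto
  thus ?case
    using W subspace_coord_space_iff[OF K] insert by simp
qed


section \<open>Frobenius and trace\<close>

locale finite_field_extension =
  fixes q h :: nat and field_type :: "'a::{field,finite} itself"
  assumes h_pos: "h > 0" and q_primepow: "primepow q" and card_field: "CARD('a) = q ^ h"
begin

lemma q_gt_1: "q > 1"
  using primepow_gt_Suc_0[OF q_primepow] by simp

text \<open>Both \<open>q\<close> and the order of the field are powers of the characteristic, so this is the binomial theorem
  in prime characteristic.\<close>

lemma frob_add: "(x + y :: 'a) ^ (q ^ i) = x ^ (q ^ i) + y ^ (q ^ i)"
proof -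
  obtain p e where p: "prime p" "q = p ^ e"
    using q_primepow by (auto simp: primepow_def)
  have prime: "prime CHAR('a)"
    by (intro prime_CHAR_semidom finite_imp_CHAR_pos) simp
  have "CHAR('a) dvd p ^ (e * h)"
    using CHAR_dvd_CARD[where ?'a = 'a] card_field p by (simp add: power_mult)
  hence "CHAR('a) = p"
    using prime p(1) prime_dvd_power primes_dvd_imp_eq by blast
  thus ?thesis
    using freshmans_dream'[OF prime, of "q ^ i" "e * i"] p by (simp add: power_mult)
qed

lemma frob_sum: "(\<Sum>i\<in>I. f i :: 'a) ^ (q ^ e) = (\<Sum>i\<in>I. f i ^ (q ^ e))"
  using q_gt_1 by (induction I rule: infinite_finite_induct) (auto simp: frob_add)

lemma frob_period: "(x :: 'a) ^ (q ^ h) = x"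
proof (cases "x = 0")
  case False
  \<comment> \<open>Multiplication by \<open>x\<close> permutes the nonzero elements; cancel their product.\<close>
  have "(\<Prod>y\<in>UNIV - {0}. x * y) = \<Prod>(UNIV - {0})"
    by (rule prod.reindex_bij_witness[of _ "\<lambda>y. y / x" "\<lambda>y. x * y"]) (use False in auto)
  hence "x ^ (CARD('a) - 1) = 1"
    by (simp add: prod.distrib card_Diff_singleton)
  thus ?thesis
    using power_minus_mult[of "CARD('a)" x] card_field q_gt_1 by simp
qed (use q_gt_1 in simp)

lemma Fq_power: "a \<in> Fq q \<Longrightarrow> a ^ (q ^ i) = (a :: 'a)"
  by (induction i) (auto simp: Fq_def power_mult mult.commute[of q])

lemma field_Fq: "field (scalar_field (Fq q :: 'a set))"
proof (rule field_scalar_fieldI)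
  fix x y :: 'a
  assume x: "x \<in> Fq q"
  have "(- x) ^ q + x ^ q = 0"
    using frob_add[of "- x" x 1, symmetric] q_gt_1 by simp
  thus "- x \<in> Fq q"
    using x by (simp add: Fq_def eq_neg_iff_add_eq_0)
  show "x + y \<in> Fq q" if "y \<in> Fq q"
    using frob_add[of x y 1] x that by (simp add: Fq_def)
qed (use q_gt_1 in \<open>auto simp: Fq_def power_mult_distrib power_inverse\<close>)

text \<open>Only this half of \<open>card (Fq q) = q\<close> is immediate. The other half is obtained later,
  from the existence of a trace code with \<open>q ^ h\<close> words.\<close>

lemma card_Fq_le: "card (Fq q :: 'a set) \<le> q"
proof -
  define p :: "'a poly" where "p = Polynomial.monom 1 q - Polynomial.monom 1 1"
  have "p \<noteq> 0"
    using q_gt_1 by (auto simp: p_def poly_eq_iff)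
  have "Fq q = {x. poly p x = 0}"
    by (auto simp: Fq_def p_def poly_monom)
  also have "card \<dots> \<le> degree p"
    by (rule card_poly_roots_bound) fact
  also have "\<dots> \<le> q"
    unfolding p_def using q_gt_1 by (intro degree_diff_le) (auto simp: degree_monom_eq)
  finally show ?thesis .
qed

definition trace :: "'a \<Rightarrow> 'a" where
  "trace x = (\<Sum>i<h. x ^ (q ^ i))"

lemma trace_mult_power: "trace (c * \<alpha> ^ j) = (\<Sum>i<h. c ^ (q ^ i) * (\<alpha> ^ (q ^ i)) ^ j)"
  by (simp add: trace_def power_mult_distrib mult.commute flip: power_mult)

lemma trace_add: "trace (x + y) = trace x + trace y"
  by (simp add: trace_def frob_add sum.distrib)

lemma trace_diff: "trace (x - y) = trace x - trace y"
  using trace_add[of "x - y" y] by simp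

lemma trace_scale: "a \<in> Fq q \<Longrightarrow> trace (a * x) = a * trace x"
  by (simp add: trace_def power_mult_distrib Fq_power sum_distrib_left)

lemma trace_in_Fq: "trace x \<in> Fq q"
proof -
  have "trace x ^ q = (\<Sum>i<h. x ^ (q ^ Suc i))"
    using frob_sum[of "\<lambda>i. x ^ (q ^ i)" "{..<h}" 1]
    by (simp add: trace_def power_mult mult.commute[of q])
  also have "\<dots> + x = (\<Sum>i<Suc h. x ^ (q ^ i))"
    by (subst sum.lessThan_Suc_shift) (simp add: add.commute)
  also have "\<dots> = trace x + x"
    by (simp add: trace_def frob_period)
  finally show ?thesis
    by (simp add: Fq_def)
qed


section \<open>Conjugates\<close>

text \<open>Injectivity on pairs expresses two things at once: every element of \<open>A\<close> has \<open>h\<close> distinct conjugates,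
  and different elements of \<open>A\<close> are never conjugate to each other.\<close>

definition conjugates_distinct :: "'a set \<Rightarrow> bool" where
  "conjugates_distinct A \<longleftrightarrow> inj_on (\<lambda>(\<alpha>, i). \<alpha> ^ (q ^ i)) (A \<times> {..<h})"

lemma conjugates_distinct_subset:
  "conjugates_distinct B \<Longrightarrow> A \<subseteq> B \<Longrightarrow> conjugates_distinct A"
  unfolding conjugates_distinct_def by (erule inj_on_subset) auto

lemma funpow_frob: "((\<lambda>y :: 'a. y ^ q) ^^ i) x = x ^ (q ^ i)"
  by (induction i) (auto simp: power_mult mult.commute[of q])

lemma orbit_frob: "orbit (\<lambda>y :: 'a. y ^ q) x = (\<lambda>i. x ^ (q ^ i)) ` {..<h}"
  using orbit_altdef_bounded[of h "\<lambda>y. y ^ q" x] h_pos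
  by (auto simp: funpow_frob frob_period)

lemma is_Lambda_conjugates_distinct:
  fixes \<Lambda> :: "'a set"
  assumes "is_Lambda h q \<Lambda>"
  shows "conjugates_distinct \<Lambda>"
proof -
  let ?f = "\<lambda>y :: 'a. y ^ q"
  have self: "x \<in> orbit ?f x" for x
    using h_pos by (auto simp: orbit_frob intro!: image_eqI[of _ _ 0])
  have orb: "orbit ?f x \<in> frob_orbits_of_size h q" if x: "x \<in> \<Lambda>" for x
  proof -
    obtain y where y: "x \<in> orbit ?f y" "card (orbit ?f y) = h"
      using assms x by (auto simp: is_Lambda_def frob_orbits_of_size_def)
    have "cyclic_on ?f (orbit ?f y)"
      using self unfolding cyclic_on_def by blast
    hence "orbit ?f x = orbit ?f y"
      using y(1) by (rule orbit_cyclic_eq3)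
    thus ?thesis
      using y(2) by (auto simp: frob_orbits_of_size_def)
  qed
  have "\<alpha> = \<beta> \<and> i = j"
    if \<alpha>: "\<alpha> \<in> \<Lambda>" and \<beta>: "\<beta> \<in> \<Lambda>" and ij: "i < h" "j < h" and eq: "\<alpha> ^ (q ^ i) = \<beta> ^ (q ^ j)"
    for \<alpha> \<beta> i j
  proof -
    have "\<alpha> ^ (q ^ i) \<in> orbit ?f \<alpha>" "\<beta> ^ (q ^ j) \<in> orbit ?f \<beta>"
      using ij by (auto simp: orbit_frob)
    hence "\<alpha> ^ (q ^ i) \<in> orbit ?f \<alpha>" "\<alpha> ^ (q ^ i) \<in> orbit ?f \<beta>"
      by (simp_all add: eq)
    hence "\<beta> \<in> orbit ?f \<alpha>"
      using orbit_swap[OF self] orbit_trans by metis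
    hence ab: "\<alpha> = \<beta>"
      using assms orb[OF \<alpha>] \<alpha> \<beta> self[of \<alpha>] unfolding is_Lambda_def by blast
    have "card ((\<lambda>i. \<alpha> ^ (q ^ i)) ` {..<h}) = card {..<h}"
      using orb[OF \<alpha>] by (auto simp: frob_orbits_of_size_def orbit_frob)
    hence "inj_on (\<lambda>i. \<alpha> ^ (q ^ i)) {..<h}"
      by (intro eq_card_imp_inj_on) auto
    thus ?thesis
      using ab ij eq by (auto simp: inj_on_def)
  qed
  thus ?thesis
    unfolding conjugates_distinct_def inj_on_def by auto
qed

text \<open>Expanding the traces turns the hypothesis into a linear relation between the Vandermonde
  vectors of all conjugates of elements of \<open>A\<close>, in which \<open>\<alpha> ^ (q ^ i)\<close> has coefficient \<open>c \<alpha> ^ (q ^ i)\<close>. The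
  coefficients with \<open>i = 0\<close> are the \<open>c \<alpha>\<close> themselves.\<close>

lemma traces_independent:
  assumes dist: "conjugates_distinct A" and card: "h * card A \<le> n"
    and zero: "\<And>j. j < n \<Longrightarrow> (\<Sum>\<alpha>\<in>A. trace (c \<alpha> * \<alpha> ^ j)) = 0" and \<alpha>: "\<alpha> \<in> A"
  shows "c \<alpha> = 0"
proof -
  let ?x = "\<lambda>(\<alpha> :: 'a, i). \<alpha> ^ (q ^ i)" and ?c = "\<lambda>(\<alpha>, i). c \<alpha> ^ (q ^ i)"
  have "?c (\<alpha>, 0) = 0"
  proof (rule vandermonde_independent[where f = ?x and n = n])
    show "finite (A \<times> {..<h})" "(\<alpha>, 0) \<in> A \<times> {..<h}"
      using \<alpha> h_pos by auto
    show "inj_on ?x (A \<times> {..<h})"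
      using dist by (simp add: conjugates_distinct_def)
    show "card (A \<times> {..<h}) \<le> n"
      using card by (simp add: card_cartesian_product mult.commute)
    show "(\<Sum>p\<in>A \<times> {..<h}. ?c p * ?x p ^ j) = 0" if "j < n" for j
      using zero[OF that]
      by (simp add: trace_mult_power sum.cartesian_product split_beta)
  qed
  thus ?thesis
    by simp
qed

text \<open>Raising the combination to the power \<open>q\<close> does not change it, but moves the coefficient
  \<open>a i ^ q\<close> to the next conjugate, cyclically. Comparing coefficients gives
  \<open>a (i + 1) = a i ^ q\<close>.\<close>

lemma coefficients_of_rational_combination:
  assumes dist: "conjugates_distinct {\<alpha>}" and hn: "h \<le> n"
    and rat: "\<And>j. j < n \<Longrightarrow> (\<Sum>i<h. a i * (\<alpha> ^ (q ^ i)) ^ j) \<in> Fq q"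
    and i: "i < h"
  shows "a i = a 0 ^ (q ^ i)"
proof -
  obtain m where m: "h = Suc m"
    using h_pos by (cases h) auto
  \<comment> \<open>The coefficients after applying Frobenius: the last one wraps around to conjugate \<open>0\<close>, since
    \<open>\<alpha> ^ (q ^ h) = \<alpha>\<close>.\<close>
  define b where "b i = (case i of 0 \<Rightarrow> a m ^ q | Suc l \<Rightarrow> a l ^ q)" for i
  have ab: "a i - b i = 0" if "i < h" for i
  proof (rule vandermonde_independent[where f = "\<lambda>i. \<alpha> ^ (q ^ i)" and n = n])
    show "finite {..<h}" "i \<in> {..<h}" "card {..<h} \<le> n"
      using that hn by auto
    show "inj_on (\<lambda>i. \<alpha> ^ (q ^ i)) {..<h}"
      using dist by (auto simp: conjugates_distinct_def inj_on_def)
    show "(\<Sum>i<h. (a i - b i) * (\<alpha> ^ (q ^ i)) ^ j) = 0" if j: "j < n" for j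
    proof -
      let ?x = "\<lambda>i. (\<alpha> ^ (q ^ i)) ^ j"
      have x: "?x i ^ q = ?x (Suc i)" for i
        by (simp add: mult_ac flip: power_mult)
      have "(\<Sum>i<h. a i * ?x i) = (\<Sum>i<h. a i * ?x i) ^ q"
        using rat[OF j] by (simp add: Fq_def)
      also have "\<dots> = (\<Sum>i<h. a i ^ q * ?x (Suc i))"
        using frob_sum[of "\<lambda>i. a i * ?x i" "{..<h}" 1] x by (simp add: power_mult_distrib)
      also have "\<dots> = (\<Sum>i<m. b (Suc i) * ?x (Suc i)) + b 0 * ?x h"
        unfolding m by (simp add: b_def)
      also have "?x h = ?x 0"
        by (simp add: frob_period)
      also have "(\<Sum>i<m. b (Suc i) * ?x (Suc i)) + b 0 * ?x 0 = (\<Sum>i<h. b i * ?x i)"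
        unfolding m by (subst sum.lessThan_Suc_shift) (simp add: add.commute)
      finally show ?thesis
        by (simp add: left_diff_distrib sum_subtractf)
    qed
  qed
  show ?thesis
    using i
  proof (induction i)
    case (Suc i)
    hence "a (Suc i) = a i ^ q"
      using ab[of "Suc i"] by (simp add: b_def)
    thus ?case
      using Suc by (simp add: mult.commute[of q] flip: power_mult)
  qed simp
qed


section \<open>Trace codes\<close>

text \<open>The trace code of \<open>\<alpha>\<close> turns out to be the subspace of \<open>K\<^sup>n\<close> that underlies \<open>X(P\<^sub>\<alpha>)\<close>.\<close>

definition trace_vec :: "nat \<Rightarrow> 'a \<Rightarrow> 'a \<Rightarrow> 'a vec" where
  "trace_vec n \<alpha> c = vec n (\<lambda>j. trace (c * \<alpha> ^ j))"

definition trace_code :: "nat \<Rightarrow> 'a \<Rightarrow> 'a vec set" where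
  "trace_code n \<alpha> = range (trace_vec n \<alpha>)"

lemma subspace_trace_code:
  "VectorSpace.subspace (scalar_field (Fq q)) (trace_code n \<alpha>) (coord_space (Fq q) n)"
  unfolding subspace_coord_space_iff[OF field_Fq]
proof (intro conjI ballI)
  have tr0: "trace 0 = 0"
    using trace_diff[of 0 0] by simp
  show "trace_code n \<alpha> \<subseteq> coord_vecs (Fq q) n"
    by (auto simp: trace_code_def trace_vec_def trace_in_Fq)
  have "0\<^sub>v n = trace_vec n \<alpha> 0"
    by (auto simp: trace_vec_def tr0)
  thus "0\<^sub>v n \<in> trace_code n \<alpha>"
    by (simp add: trace_code_def)
  fix v assume "v \<in> trace_code n \<alpha>"
  then obtain c where v: "v = trace_vec n \<alpha> c"
    by (auto simp: trace_code_def)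
  show "v + w \<in> trace_code n \<alpha>" if w: "w \<in> trace_code n \<alpha>" for w
  proof -
    obtain d where "w = trace_vec n \<alpha> d"
      using w by (auto simp: trace_code_def)
    hence "v + w = trace_vec n \<alpha> (c + d)"
      unfolding v by (auto simp: trace_vec_def trace_add distrib_right)
    thus ?thesis
      by (simp add: trace_code_def)
  qed
  show "a \<cdot>\<^sub>v v \<in> trace_code n \<alpha>" if a: "a \<in> Fq q" for a
  proof -
    have "a \<cdot>\<^sub>v v = trace_vec n \<alpha> (a * c)"
      unfolding v using a by (auto simp: trace_vec_def trace_scale mult.assoc)
    thus ?thesis
      by (simp add: trace_code_def)
  qed
qed

lemmas trace_code_subset = subspace_trace_code[unfolded subspace_coord_space_iff[OF field_Fq],
    THEN conjunct1]

lemma card_trace_code: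
  assumes "conjugates_distinct {\<alpha>}" and "h \<le> n"
  shows "card (trace_code n \<alpha>) = q ^ h"
proof -
  have "inj (trace_vec n \<alpha>)"
  proof (rule injI)
    fix c d assume "trace_vec n \<alpha> c = trace_vec n \<alpha> d"
    hence "trace (c * \<alpha> ^ j) = trace (d * \<alpha> ^ j)" if "j < n" for j
      using that by (auto simp: trace_vec_def vec_eq_iff)
    hence "trace ((c - d) * \<alpha> ^ j) = 0" if "j < n" for j
      using that by (simp add: left_diff_distrib trace_diff)
    hence "c - d = 0"
      using traces_independent[OF assms(1), of n "\<lambda>_. c - d" \<alpha>] assms(2) by simp
    thus "c = d"
      by simp
  qed
  thus ?thesis
    by (simp add: trace_code_def card_image card_field)
qed

text \<open>The trace code of length \<open>h\<close> consists of \<open>q ^ h\<close> vectors with \<open>h\<close> entries in \<open>Fq q\<close>, so \<open>Fq q\<close>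
  cannot have fewer than \<open>q\<close> elements.\<close>

lemma card_Fq:
  assumes "conjugates_distinct {\<alpha> :: 'a}"
  shows "card (Fq q :: 'a set) = q"
proof -
  have "q ^ h = card (trace_code h \<alpha>)"
    using card_trace_code[OF assms, of h] by simp
  also have "\<dots> \<le> card (coord_vecs (Fq q :: 'a set) h)"
    using trace_code_subset by (intro card_mono card_coord_vecs)
  also have "\<dots> = card (Fq q :: 'a set) ^ h"
    by (rule card_coord_vecs)
  finally have "q \<le> card (Fq q :: 'a set)"
    using h_pos power_le_imp_le_base power_mono_iff by blast
  thus ?thesis
    using card_Fq_le by simp
qed

lemma dim_trace_code:
  assumes "conjugates_distinct {\<alpha>}" and "h \<le> n"
  shows "vectorspace.dim (scalar_field (Fq q)) ((coord_space (Fq q) n)\<lparr>carrier := trace_code n \<alpha>\<rparr>) = h"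
proof -
  interpret V: vectorspace "scalar_field (Fq q :: 'a set)" "coord_space (Fq q) n"
    by (rule vectorspace_coord_space[OF field_Fq])
  interpret W: vectorspace "scalar_field (Fq q :: 'a set)" "V.vs (trace_code n \<alpha>)"
    by (rule V.subspace_is_vs[OF subspace_trace_code])
  have "finite (trace_code n \<alpha>)"
    by (simp add: trace_code_def)
  hence "q ^ h = q ^ W.dim"
    using W.card_eq_card_power_dim card_trace_code[OF assms] card_Fq[OF assms(1)] by simp
  thus ?thesis
    using q_gt_1 by simp
qed


section \<open>The pseudo-arc\<close>

text \<open>The image of all multiples of \<open>v\<close> is again the set of all multiples of a vector because every
  scalar is a \<open>q\<close>-th power.\<close>

lemma Psi_proj_point:
  "Psi q (proj_point (v :: 'a vec)) = proj_point (map_vec (\<lambda>x. x ^ q) v)"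
proof -
  have surj: "\<exists>b. a = b ^ q" for a :: 'a
  proof
    have "(a ^ (q ^ (h - 1))) ^ q = a ^ (q ^ Suc (h - 1))"
      by (simp add: mult.commute flip: power_mult)
    thus "a = (a ^ (q ^ (h - 1))) ^ q"
      using h_pos frob_period by simp
  qed
  have map: "map_vec (\<lambda>x. x ^ q) (c \<cdot>\<^sub>v v) = c ^ q \<cdot>\<^sub>v map_vec (\<lambda>x. x ^ q) v" for c
    by (auto simp: power_mult_distrib)
  show ?thesis
  proof
    show "Psi q (proj_point v) \<subseteq> proj_point (map_vec (\<lambda>x. x ^ q) v)"
      by (auto simp: Psi_def proj_point_def map)
    show "proj_point (map_vec (\<lambda>x. x ^ q) v) \<subseteq> Psi q (proj_point v)"
    proof
      fix x assume "x \<in> proj_point (map_vec (\<lambda>x. x ^ q) v)"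
      then obtain a where a: "x = a \<cdot>\<^sub>v map_vec (\<lambda>x. x ^ q) v"
        by (auto simp: proj_point_def)
      obtain b where "a = b ^ q"
        using surj by blast
      hence "x = map_vec (\<lambda>x. x ^ q) (b \<cdot>\<^sub>v v)"
        by (simp add: a map)
      thus "x \<in> Psi q (proj_point v)"
        by (auto simp: Psi_def proj_point_def)
    qed
  qed
qed

lemma funpow_Psi_P_pt: "(Psi q ^^ i) (P_pt n \<alpha>) = P_pt n ((\<alpha> :: 'a) ^ (q ^ i))"
proof (induction i)
  case (Suc i)
  have "map_vec (\<lambda>x. x ^ q) (vec n (\<lambda>j. (\<alpha> ^ (q ^ i)) ^ j)) = vec n (\<lambda>j. (\<alpha> ^ (q ^ Suc i)) ^ j)"
    by (auto simp: mult_ac simp flip: power_mult)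
  thus ?case
    using Suc by (simp add: P_pt_def Psi_proj_point)
qed simp

text \<open>The vectors underlying \<open>X\<^sup>*(P\<^sub>\<alpha>)\<close>: the span over the large field of the Vandermonde vectors of the
  conjugates of \<open>\<alpha>\<close>.\<close>

definition conjugate_span :: "nat \<Rightarrow> 'a \<Rightarrow> 'a vec set" where
  "conjugate_span n \<alpha> = range (\<lambda>a. vec n (\<lambda>j. \<Sum>i<h. a i * (\<alpha> ^ (q ^ i)) ^ j))"

lemma subspace_conjugate_span:
  "VectorSpace.subspace (scalar_field UNIV) (conjugate_span n \<alpha>) (coord_space UNIV n)"
  unfolding subspace_coord_space_iff[OF field_scalar_field_UNIV]
proof (intro conjI ballI)
  let ?v = "\<lambda>a. vec n (\<lambda>j. \<Sum>i<h. a i * (\<alpha> ^ (q ^ i)) ^ j)"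
  show "conjugate_span n \<alpha> \<subseteq> coord_vecs UNIV n"
    by (auto simp: conjugate_span_def)
  have "0\<^sub>v n = ?v (\<lambda>_. 0)"
    by auto
  thus "0\<^sub>v n \<in> conjugate_span n \<alpha>"
    unfolding conjugate_span_def by (rule range_eqI[where x = "\<lambda>_. 0"])
  fix v assume "v \<in> conjugate_span n \<alpha>"
  then obtain a where v: "v = ?v a"
    by (auto simp: conjugate_span_def)
  show "v + w \<in> conjugate_span n \<alpha>" if w: "w \<in> conjugate_span n \<alpha>" for w
  proof -
    obtain b where "w = ?v b"
      using w by (auto simp: conjugate_span_def)
    hence "v + w = ?v (\<lambda>i. a i + b i)"
      unfolding v by (auto simp: sum.distrib distrib_right)
    thus ?thesis
      unfolding conjugate_span_def by (rule range_eqI[where x = "\<lambda>i. a i + b i"])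
  qed
  show "c \<cdot>\<^sub>v v \<in> conjugate_span n \<alpha>" for c
  proof -
    have "c \<cdot>\<^sub>v v = ?v (\<lambda>i. c * a i)"
      unfolding v by (auto simp: sum_distrib_left mult.assoc)
    thus ?thesis
      unfolding conjugate_span_def by (rule range_eqI[where x = "\<lambda>i. c * a i"])
  qed
qed

lemma X_star_P_pt:
  assumes n: "n > 0"
  shows "X_star q h n (P_pt n \<alpha>) = points_of n (conjugate_span n \<alpha>)"
  unfolding X_star_def funpow_Psi_P_pt
proof (rule proj_span_eqI[OF subspace_conjugate_span])
  let ?v = "\<lambda>i. vec n (\<lambda>j. (\<alpha> ^ (q ^ i)) ^ j)"
  \<comment> \<open>The entry at index \<open>0\<close> is \<open>1\<close>, which needs \<open>n > 0\<close>.\<close>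
  have nz: "?v i \<noteq> 0\<^sub>v n" for i
  proof
    assume "?v i = 0\<^sub>v n"
    hence "?v i $ 0 = 0\<^sub>v n $ 0"
      by simp
    thus False
      using n by simp
  qed
  have pts: "points_of n {?v i} = {P_pt n (\<alpha> ^ (q ^ i))}" for i
  proof -
    have diff: "v \<noteq> 0\<^sub>v n \<Longrightarrow> {v} - {0\<^sub>v n} = {v}" for v :: "'a vec"
      by blast
    show ?thesis
      unfolding points_of_def P_pt_def diff[OF nz] by (simp only: image_insert image_empty)
  qed
  show "(\<lambda>i. P_pt n (\<alpha> ^ (q ^ i))) ` {..<h} \<subseteq> points_of n (conjugate_span n \<alpha>)"
  proof clarify
    fix i assume i: "i < h"
    have "?v i = vec n (\<lambda>j. \<Sum>l<h. (if l = i then 1 else 0) * (\<alpha> ^ (q ^ l)) ^ j)"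
      using i by (auto simp: if_distrib[of "\<lambda>x. x * _"] cong: if_cong)
    hence "?v i \<in> conjugate_span n \<alpha>"
      unfolding conjugate_span_def by (rule range_eqI[where x = "\<lambda>l. if l = i then 1 else 0"])
    thus "P_pt n (\<alpha> ^ (q ^ i)) \<in> points_of n (conjugate_span n \<alpha>)"
      using nz by (auto simp: points_of_def P_pt_def)
  qed
  fix W
  assume W: "VectorSpace.subspace (scalar_field UNIV) W (coord_space UNIV n)"
    and sub: "(\<lambda>i. P_pt n (\<alpha> ^ (q ^ i))) ` {..<h} \<subseteq> points_of n W"
  have v: "?v i \<in> W" if "i < h" for i
  proof -
    have "{?v i} \<subseteq> W"
      using sub that
      by (intro points_of_subset_imp_subset[OF field_scalar_field_UNIV W]) (auto simp: pts)
    thus ?thesis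
      by simp
  qed
  have "vec n (\<lambda>j. \<Sum>i<h. a i * (\<alpha> ^ (q ^ i)) ^ j) \<in> W" for a
  proof (rule subspace_sum_vec_closed[OF field_scalar_field_UNIV W])
    fix i assume "i \<in> {..<h}"
    hence "a i \<cdot>\<^sub>v ?v i \<in> W"
      using v W by (simp add: subspace_coord_space_iff[OF field_scalar_field_UNIV])
    also have "a i \<cdot>\<^sub>v ?v i = vec n (\<lambda>j. a i * (\<alpha> ^ (q ^ i)) ^ j)"
      by auto
    finally show "vec n (\<lambda>j. a i * (\<alpha> ^ (q ^ i)) ^ j) \<in> W" .
  qed simp
  thus "conjugate_span n \<alpha> \<subseteq> W"
    by (auto simp: conjugate_span_def)
qed

text \<open>A rational combination has coefficients \<open>c ^ (q ^ i)\<close> with \<open>c = a 0\<close>, which is exactly the shape of an expanded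
  trace.\<close>

lemma conjugate_span_rational:
  assumes "conjugates_distinct {\<alpha>}" and "h \<le> n"
  shows "conjugate_span n \<alpha> \<inter> coord_vecs (Fq q) n = trace_code n \<alpha>"
proof
  show "conjugate_span n \<alpha> \<inter> coord_vecs (Fq q) n \<subseteq> trace_code n \<alpha>"
  proof
    fix w assume w: "w \<in> conjugate_span n \<alpha> \<inter> coord_vecs (Fq q) n"
    then obtain a where a: "w = vec n (\<lambda>j. \<Sum>i<h. a i * (\<alpha> ^ (q ^ i)) ^ j)"
      by (auto simp: conjugate_span_def)
    have coeff: "a i = a 0 ^ (q ^ i)" if "i < h" for i
      using w by (intro coefficients_of_rational_combination[OF assms _ that]) (auto simp: a)
    hence "w = trace_vec n \<alpha> (a 0)"
      unfolding a trace_vec_def trace_mult_power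
      by (intro arg_cong[where f = "vec n"] ext sum.cong refl arg_cong2[where f = "(*)"])
         (rule coeff, simp)
    thus "w \<in> trace_code n \<alpha>"
      by (simp add: trace_code_def)
  qed
  show "trace_code n \<alpha> \<subseteq> conjugate_span n \<alpha> \<inter> coord_vecs (Fq q) n"
    using trace_code_subset
    by (auto simp: trace_code_def trace_vec_def conjugate_span_def trace_mult_power)
qed

lemma X_sub_P_pt:
  assumes dist: "conjugates_distinct {\<alpha>}" and hn: "h \<le> n"
  shows "X_sub q h n (P_pt n \<alpha>) = points_of n (trace_code n \<alpha>)"
proof -
  have n: "n > 0"
    using h_pos hn by simp
  have "points_of n (conjugate_span n \<alpha>) \<inter> points_of n (coord_vecs (Fq q) n) =
        points_of n (conjugate_span n \<alpha> \<inter> coord_vecs (Fq q) n)"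
  proof
    show "points_of n (conjugate_span n \<alpha>) \<inter> points_of n (coord_vecs (Fq q) n) \<subseteq>
          points_of n (conjugate_span n \<alpha> \<inter> coord_vecs (Fq q) n)"
    proof
      fix P assume P: "P \<in> points_of n (conjugate_span n \<alpha>) \<inter> points_of n (coord_vecs (Fq q) n)"
      then obtain w where w: "P = proj_point w" "w \<in> coord_vecs (Fq q) n" "w \<noteq> 0\<^sub>v n"
        by (auto simp: points_of_def)
      have "{w} \<subseteq> conjugate_span n \<alpha>"
        by (rule points_of_subset_imp_subset[OF field_scalar_field_UNIV subspace_conjugate_span])
           (use P w in \<open>auto simp: points_of_def\<close>)
      thus "P \<in> points_of n (conjugate_span n \<alpha> \<inter> coord_vecs (Fq q) n)"
        using w by (auto simp: points_of_def)
    qed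
  qed (auto simp: points_of_def)
  thus ?thesis
    by (simp add: X_sub_def X_star_P_pt[OF n] Sigma_sub_def PG_points_def
        conjugate_span_rational[OF dist hn])
qed

text \<open>Counting proof of spanning: the sums of one codeword per \<open>\<alpha> \<in> A\<close> are parametrised injectively by
  \<open>(q ^ h) ^ k\<close> tuples, which is the number of vectors in \<open>K\<^sup>n\<close>. Being an additively closed set that
  contains the codes, \<open>W\<close> contains all these sums.\<close>

lemma trace_codes_span:
  assumes dist: "conjugates_distinct A" and k: "card A = k" "k > 0" and n: "n = h * k"
    and W: "VectorSpace.subspace (scalar_field (Fq q)) W (coord_space (Fq q) n)"
    and sub: "\<And>\<alpha>. \<alpha> \<in> A \<Longrightarrow> trace_code n \<alpha> \<subseteq> W"
  shows "coord_vecs (Fq q) n \<subseteq> W"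
proof -
  let ?g = "\<lambda>c :: 'a \<Rightarrow> 'a. vec n (\<lambda>j. \<Sum>\<alpha>\<in>A. trace (c \<alpha> * \<alpha> ^ j))"
  let ?D = "A \<rightarrow>\<^sub>E (UNIV :: 'a set)"
  have inj: "inj_on ?g ?D"
  proof (rule inj_onI)
    fix c d assume cd: "c \<in> ?D" "d \<in> ?D" "?g c = ?g d"
    have "c \<alpha> - d \<alpha> = 0" if "\<alpha> \<in> A" for \<alpha>
    proof (rule traces_independent[OF dist _ _ that])
      show "h * card A \<le> n"
        by (simp add: n k)
      fix j assume "j < n"
      hence "(\<Sum>\<alpha>\<in>A. trace (c \<alpha> * \<alpha> ^ j)) = (\<Sum>\<alpha>\<in>A. trace (d \<alpha> * \<alpha> ^ j))"
        using cd(3) by (simp add: vec_eq_iff)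
      thus "(\<Sum>\<alpha>\<in>A. trace ((c \<alpha> - d \<alpha>) * \<alpha> ^ j)) = 0"
        by (simp add: left_diff_distrib trace_diff sum_subtractf)
    qed
    thus "c = d"
      using cd(1,2) by (intro PiE_ext) auto
  qed
  \<comment> \<open>The order of the subfield comes from the trace code of any one element of \<open>A\<close>.\<close>
  obtain \<alpha> where "\<alpha> \<in> A"
    using k by fastforce
  hence "card (Fq q :: 'a set) = q"
    using card_Fq conjugates_distinct_subset[OF dist] by blast
  hence "card (coord_vecs (Fq q :: 'a set) n) = card ?D"
    by (simp add: card_coord_vecs card_PiE card_field k n power_mult)
  also have "\<dots> = card (?g ` ?D)"
    using inj by (simp add: card_image)
  finally have card: "card (coord_vecs (Fq q :: 'a set) n) = card (?g ` ?D)" .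
  have gW: "?g c \<in> W" for c
  proof (rule subspace_sum_vec_closed[OF field_Fq W])
    show "vec n (\<lambda>j. trace (c \<alpha> * \<alpha> ^ j)) \<in> W" if "\<alpha> \<in> A" for \<alpha>
      using sub[OF that] by (auto simp: trace_code_def trace_vec_def)
  qed simp
  have "?g ` ?D \<subseteq> coord_vecs (Fq q) n"
    using gW W unfolding subspace_coord_space_iff[OF field_Fq] by blast
  hence "?g ` ?D = coord_vecs (Fq q) n"
    using card card_coord_vecs(1) by (intro card_subset_eq) auto
  moreover have "?g ` ?D \<subseteq> W"
    using gW by blast
  ultimately show ?thesis
    by simp
qed

text \<open>A set of \<open>k\<close> members of the family is the image of \<open>k\<close> elements of \<open>\<Lambda>\<close> even when the parametrisation
  by \<open>\<Lambda>\<close> is not injective (as for \<open>k = 1\<close>): choose one parameter for each member. Then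
  \<open>trace_codes_span\<close> applies to the chosen parameters.\<close>

lemma pseudo_arc_P_family:
  fixes \<Lambda> :: "'a set"
  assumes k: "k > 0" and dist: "conjugates_distinct \<Lambda>"
  shows "pseudo_arc (Fq q) h k (P_family h k q \<Lambda>)"
proof -
  let ?n = "h * k"
  have hn: "h \<le> ?n"
    using k by simp
  have d1: "conjugates_distinct {\<alpha>}" if "\<alpha> \<in> \<Lambda>" for \<alpha>
    using conjugates_distinct_subset[OF dist] that by simp
  let ?X = "\<lambda>\<alpha> :: 'a. X_sub q h ?n (P_pt ?n \<alpha>)"
  have X: "?X \<alpha> = points_of ?n (trace_code ?n \<alpha>)" if "\<alpha> \<in> \<Lambda>" for \<alpha>
    using X_sub_P_pt[OF d1[OF that] hn] .
  have fam: "P_family h k q \<Lambda> = ?X ` \<Lambda>"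
    by (auto simp: P_family_def)
  have "proj_subspace_dim (Fq q) ?n (h - 1) (?X \<alpha>)" if "\<alpha> \<in> \<Lambda>" for \<alpha>
    unfolding proj_subspace_dim_def
    using subspace_trace_code dim_trace_code[OF d1[OF that] hn] X[OF that] h_pos
    by (intro exI[of _ "trace_code ?n \<alpha>"]) simp
  moreover have "proj_span (Fq q) ?n (\<Union>T) = PG_points (Fq q) ?n"
    if T: "T \<subseteq> ?X ` \<Lambda>" "finite T" "card T = k" for T
  proof -
    obtain A where A: "A \<subseteq> \<Lambda>" "inj_on ?X A" "T = ?X ` A"
      using T(1) unfolding subset_image_inj by blast
    have cardA: "card A = k"
      using A T(3) by (simp add: card_image)
    have "proj_span (Fq q) ?n (\<Union>T) = points_of ?n (coord_vecs (Fq q) ?n)"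
    proof (rule proj_span_eqI)
      show "VectorSpace.subspace (scalar_field (Fq q :: 'a set)) (coord_vecs (Fq q) ?n)
              (coord_space (Fq q) ?n)"
        using scalar_field_closed[OF field_Fq]
        by (auto simp: subspace_coord_space_iff[OF field_Fq])
      show "\<Union>T \<subseteq> points_of ?n (coord_vecs (Fq q) ?n)"
      proof
        fix P assume "P \<in> \<Union>T"
        then obtain \<alpha> where "\<alpha> \<in> \<Lambda>" "P \<in> ?X \<alpha>"
          using A by blast
        hence "P \<in> points_of ?n (trace_code ?n \<alpha>)"
          using X by blast
        thus "P \<in> points_of ?n (coord_vecs (Fq q) ?n)"
          using trace_code_subset[of ?n \<alpha>] unfolding points_of_def by blast
      qed
      fix W
      assume W: "VectorSpace.subspace (scalar_field (Fq q)) W (coord_space (Fq q :: 'a set) ?n)"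
        and sub: "\<Union>T \<subseteq> points_of ?n W"
      have "trace_code ?n \<alpha> \<subseteq> W" if "\<alpha> \<in> A" for \<alpha>
        using sub A X that
        by (intro points_of_subset_imp_subset[OF field_Fq W trace_code_subset]) blast
      thus "coord_vecs (Fq q) ?n \<subseteq> W"
        using trace_codes_span[OF conjugates_distinct_subset[OF dist A(1)] cardA k refl W] by blast
    qed
    thus ?thesis
      by (simp add: PG_points_def)
  qed
  ultimately show ?thesis
    unfolding pseudo_arc_def fam by blast
qed

text \<open>If two parameters \<open>\<alpha>\<close> and \<open>\<beta>\<close> gave the same code, then the codeword of \<open>\<alpha>\<close> at \<open>1\<close> would also be a codeword of
  \<open>\<beta>\<close>, a relation between \<open>2 h \<le> h k\<close> independent vectors.\<close>

lemma card_P_family: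
  fixes \<Lambda> :: "'a set"
  assumes k: "k \<ge> 2" and dist: "conjugates_distinct \<Lambda>"
  shows "card (P_family h k q \<Lambda>) = card \<Lambda>"
proof -
  let ?n = "h * k"
  let ?X = "\<lambda>\<alpha> :: 'a. X_sub q h ?n (P_pt ?n \<alpha>)"
  have hn: "h \<le> ?n"
    using k by simp
  have "inj_on ?X \<Lambda>"
  proof (rule inj_onI, rule ccontr)
    fix \<alpha> \<beta> assume ab: "\<alpha> \<in> \<Lambda>" "\<beta> \<in> \<Lambda>" "?X \<alpha> = ?X \<beta>" "\<alpha> \<noteq> \<beta>"
    have d1: "conjugates_distinct {\<alpha>}" "conjugates_distinct {\<beta>}"
      using conjugates_distinct_subset[OF dist] ab by simp_all
    have "points_of ?n (trace_code ?n \<alpha>) \<subseteq> points_of ?n (trace_code ?n \<beta>)"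
      using ab(3) unfolding X_sub_P_pt[OF d1(1) hn] X_sub_P_pt[OF d1(2) hn] by simp
    hence "trace_code ?n \<alpha> \<subseteq> trace_code ?n \<beta>"
      by (rule points_of_subset_imp_subset[OF field_Fq subspace_trace_code trace_code_subset])
    then obtain d where d: "trace_vec ?n \<alpha> 1 = trace_vec ?n \<beta> d"
      unfolding trace_code_def by blast
    \<comment> \<open>\<open>Tr(1 \<cdot> \<alpha>\<^sup>j) + Tr(- d \<cdot> \<beta>\<^sup>j) = 0\<close> for all \<open>j\<close> forces the coefficient \<open>1\<close> to vanish.\<close>
    define c where "c x = (if x = \<alpha> then 1 else - d)" for x
    have neg: "trace (- x) = - trace x" for x
      using trace_diff[of 0 x] trace_diff[of 0 0] by simp
    have "c \<alpha> = 0"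
    proof (rule traces_independent[where A = "{\<alpha>, \<beta>}" and n = ?n and c = c])
      show "conjugates_distinct {\<alpha>, \<beta>}"
        using conjugates_distinct_subset[OF dist] ab by simp
      show "h * card {\<alpha>, \<beta>} \<le> ?n"
      proof -
        have "card {\<alpha>, \<beta>} = 2"
          using ab(4) by simp
        thus ?thesis
          using k by (simp only: mult_le_mono2)
      qed
      fix j assume "j < ?n"
      hence "trace (\<alpha> ^ j) = trace (d * \<beta> ^ j)"
        using d by (auto simp: trace_vec_def vec_eq_iff)
      thus "(\<Sum>x\<in>{\<alpha>, \<beta>}. trace (c x * x ^ j)) = 0"
        using ab(4) by (simp add: c_def neg)
    qed simp
    thus False
      by (simp add: c_def)
  qed
  moreover have "P_family h k q \<Lambda> = ?X ` \<Lambda>"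
    by (auto simp: P_family_def)
  ultimately show ?thesis
    by (simp add: card_image)
qed

end

theorem theorem3p4:
  fixes h k q :: nat and \<Lambda> :: "'a::{field,finite} set"
  assumes "h > 0" and "k > 0"
    and "primepow q"
    and "q \<ge> h * k + 1"
    and "CARD('a) = q ^ h"
    and "is_Lambda h q \<Lambda>"
  shows "pseudo_arc (Fq q) h k (P_family h k q \<Lambda>) \<and>
         (k \<ge> 2 \<longrightarrow> card (P_family h k q \<Lambda>) = card \<Lambda>)"
proof -
  interpret finite_field_extension q h "TYPE('a)"
    by unfold_locales (use assms in auto)
  have "conjugates_distinct \<Lambda>"
    by (rule is_Lambda_conjugates_distinct) fact
  thus ?thesis
    using pseudo_arc_P_family[OF \<open>k > 0\<close>] card_P_family by blast
qed

end
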